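(* Let $\mathcal{T}(m)$ denote the number of iterations of the Pisano period $\pi$ applied to $m$ until the trajectory of $m$ reaches a fixed point. Then $\limsup_{m\to\infty} \frac{\mathcal{T}(m)}{\log m} < \infty$.
   Context: The Fibonacci sequence is $F_0=0$, $F_1=1$, $F_n=F_{n-1}+F_{n-2}$. For an integer $m>1$, $\pi(m)$ (the Pisano period) is the length of the shortest period of the Fibonacci sequence modulo $m$; iterates are $\pi^{i+1}(m)=\pi(\pi^i(m))$. A fixed point is an integer $m>1$ with $\pi(m)=m$; every trajectory $m,\pi(m),\pi^2(m),\dots$ of an integer $m>1$ eventually reaches a fixed point, and $\mathcal{T}(m)$ is the least $j\ge0$ such that $\pi^j(m)$ is a fixed point (e.g. $\mathcal{T}(2)=4$, $\mathcal{T}(24)=0$). *)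

theory Defs
  imports Complex_Main "HOL-Number_Theory.Fib" "HOL-Number_Theory.Cong" "HOL-Library.Extended_Real"
    "HOL-Library.Liminf_Limsup"
begin

(* Only meaningful for m > 0: for m = 0 there is no period and the value is unspecified. *)
definition pisano :: "nat \<Rightarrow> nat" where
  "pisano m = (LEAST k. k > 0 \<and> (\<forall>n. [fib (n + k) = fib n] (mod m)))"

definition pisano_fixed_point :: "nat \<Rightarrow> bool" where
  "pisano_fixed_point m \<longleftrightarrow> m > 1 \<and> pisano m = m"

(* Valued in enat, as an infimum, so that a trajectory never meeting a fixed point would
   get the value \<infinity> (Inf {} = \<infinity>) rather than an unspecified natural number. *)
definition pisano_iterations :: "nat \<Rightarrow> enat" where
  "pisano_iterations m = (INF j \<in> {j. pisano_fixed_point ((pisano ^^ j) m)}. enat j)"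

end

theory Submission
  imports Defs "HOL-Number_Theory.Residues"
begin

text \<open>The Pisano map commutes with least common multiples, so the number of iterations for \<open>m\<close> is
  at most the maximum over the prime powers dividing \<open>m\<close>. For a prime \<open>p \<noteq> 2, 5\<close>, the period of
  \<open>p\<^sup>k\<close> divides \<open>p\<^sup>k\<^sup>-\<^sup>1 \<cdot> 4h\<close> with \<open>2h \<le> p + 1\<close>, so every odd prime power dividing it is at
  most \<open>2p\<^sup>k/3\<close>, while the powers of 2 dividing it are at most \<open>4p\<close>. Powers of 2 and of 5 reach a fixed point after a number of steps linear in the exponent, and iterating the
  reduction gives a logarithmic bound.\<close>

section \<open>Periods of the Fibonacci sequence modulo m\<close>

definition fib_period :: "nat \<Rightarrow> nat \<Rightarrow> bool" where
  "fib_period m k \<longleftrightarrow> int m dvd int (fib k) \<and> int m dvd int (fib (Suc k)) - 1"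

text \<open>The usual addition formula, with F(n-1) written as F(n+1) - F(n) so that it also covers
  \<open>n = 0\<close>.\<close>

lemma int_fib_add:
  "int (fib (n + k)) = int (fib n) * int (fib (Suc k)) + (int (fib (Suc n)) - int (fib n)) * int (fib k)"
  by (induction n rule: fib.induct) (auto simp: algebra_simps)

lemma int_fib_Suc_add:
  "int (fib (Suc (n + k))) = int (fib (Suc n)) * int (fib (Suc k)) + int (fib n) * int (fib k)"
  by (simp only: fib_add of_nat_add of_nat_mult mult.commute)

text \<open>By the addition formula, F(n+k) - F(n) is an integer combination of F(k) and F(k+1) - 1;
  conversely, take \<open>n = 0\<close> and \<open>n = 1\<close>.\<close>

lemma fib_period_iff: "fib_period m k \<longleftrightarrow> (\<forall>n. [fib (n + k) = fib n] (mod m))"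
proof
  assume k: "fib_period m k"
  have "int m dvd int (fib (n + k)) - int (fib n)" for n
  proof -
    have "int (fib (n + k)) - int (fib n)
        = int (fib n) * (int (fib (Suc k)) - 1) + (int (fib (Suc n)) - int (fib n)) * int (fib k)"
      by (simp add: int_fib_add algebra_simps)
    then show ?thesis
      using k by (simp add: fib_period_def del: fib.simps)
  qed
  then show "\<forall>n. [fib (n + k) = fib n] (mod m)"
    by (simp add: cong_iff_dvd_diff flip: cong_int_iff)
next
  assume "\<forall>n. [fib (n + k) = fib n] (mod m)"
  then have "int m dvd int (fib (n + k)) - int (fib n)" for n
    by (simp add: cong_iff_dvd_diff flip: cong_int_iff)
  from this[of 0] this[of 1] show "fib_period m k"
    by (simp add: fib_period_def)
qed

lemma fib_period_add: "fib_period m a \<Longrightarrow> fib_period m b \<Longrightarrow> fib_period m (a + b)"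
  unfolding fib_period_iff by (metis add.assoc cong_trans)

lemma fib_period_cancel: "fib_period m (a + b) \<Longrightarrow> fib_period m a \<Longrightarrow> fib_period m b"
  unfolding fib_period_iff by (metis add.assoc add.commute cong_sym cong_trans)

lemma fib_period_0: "fib_period m 0"
  by (simp add: fib_period_def)

lemma fib_period_mult: "fib_period m a \<Longrightarrow> fib_period m (c * a)"
  by (induction c) (auto simp: fib_period_0 fib_period_add)

text \<open>Pigeonhole makes some pair of consecutive residues repeat. The recurrence can be run
  backwards, so the repetition descends to the initial pair.\<close>

lemma ex_fib_period:
  assumes "m > 0"
  shows "\<exists>k>0. fib_period m k"
proof -
  define f where "f n = (fib n mod m, fib (Suc n) mod m)" for n
  have "range f \<subseteq> {..<m} \<times> {..<m}"
    using assms by (auto simp: f_def)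
  then have "\<not> inj f"
    by (meson finite_SigmaI finite_lessThan infinite_UNIV_nat inj_on_finite)
  then obtain i j where "i < j" "f i = f j"
    by (metis injI linorder_neqE_nat)
  define k where "k = j - i"
  have "k > 0" using \<open>i < j\<close> by (simp add: k_def)
  have "f (n + k) = f n \<Longrightarrow> f k = f 0" for n
  proof (induction n)
    case (Suc n)
    have c: "[fib (Suc n + k) = fib (Suc n)] (mod m)"
            "[fib (Suc (Suc n + k)) = fib (Suc (Suc n))] (mod m)"
      using Suc.prems by (simp_all add: f_def cong_def del: fib.simps)
    from c have "[fib (n + k) = fib n] (mod m)"
      by (simp add: cong_add_lcancel_nat) (metis cong_add_lcancel_nat cong_add_rcancel_nat cong_trans cong_sym)
    with c show ?case
      by (intro Suc.IH) (simp add: f_def cong_def del: fib.simps)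
  qed auto
  moreover have "f (i + k) = f i"
    using \<open>i < j\<close> \<open>f i = f j\<close> by (simp add: k_def)
  ultimately have "f k = f 0" by blast
  then have "[fib k = 0] (mod m)" "[fib (Suc k) = 1] (mod m)"
    by (simp_all add: f_def cong_def)
  then have "fib_period m k"
    by (simp add: fib_period_def cong_iff_dvd_diff del: fib.simps flip: cong_int_iff)
  with \<open>k > 0\<close> show ?thesis by blast
qed

lemma pisano_period:
  assumes "m > 0"
  shows "pisano m > 0" "fib_period m (pisano m)"
proof -
  have "\<exists>k. k > 0 \<and> fib_period m k"
    using ex_fib_period[OF assms] by blast
  from LeastI_ex[OF this] show "pisano m > 0" "fib_period m (pisano m)"
    by (simp_all add: pisano_def fib_period_iff)
qed

lemma pisano_le: "k > 0 \<Longrightarrow> fib_period m k \<Longrightarrow> pisano m \<le> k"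
  unfolding pisano_def fib_period_iff by (rule Least_le) simp

text \<open>The remainder of a period modulo \<open>pisano m\<close> is again a period, hence 0 by
  minimality.\<close>

lemma pisano_dvd_iff:
  assumes "m > 0"
  shows "pisano m dvd k \<longleftrightarrow> fib_period m k"
proof
  assume "pisano m dvd k"
  then show "fib_period m k"
    by (metis assms dvdE fib_period_mult mult.commute pisano_period(2))
next
  assume "fib_period m k"
  then have "fib_period m ((k div pisano m) * pisano m + k mod pisano m)"
    by simp
  then have "fib_period m (k mod pisano m)"
    using fib_period_cancel fib_period_mult pisano_period(2)[OF assms] by blast
  moreover have "k mod pisano m < pisano m"
    using pisano_period(1)[OF assms] by simp
  ultimately have "k mod pisano m = 0"
    using pisano_le by (metis gr0I leD)
  then show "pisano m dvd k" by auto
qed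

lemma fib_period_lcm: "fib_period (lcm a b) k \<longleftrightarrow> fib_period a k \<and> fib_period b k"
  unfolding fib_period_def lcm_int_int_eq[symmetric] lcm_least_iff by blast

text \<open>Both sides have the same multiples, namely the common periods modulo \<open>a\<close>
  and \<open>b\<close>.\<close>

lemma pisano_lcm:
  assumes "a > 0" "b > 0"
  shows "pisano (lcm a b) = lcm (pisano a) (pisano b)"
proof -
  have "pisano (lcm a b) dvd k \<longleftrightarrow> lcm (pisano a) (pisano b) dvd k" for k
    using assms by (simp add: pisano_dvd_iff fib_period_lcm lcm_pos_nat)
  then show ?thesis
    by (meson dvd_antisym dvd_refl)
qed

lemma pisano_funpow_pos: "m > 0 \<Longrightarrow> (pisano ^^ j) m > 0"
  by (induction j) (auto simp: pisano_period)

lemma pisano_funpow_lcm: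
  assumes "a > 0" "b > 0"
  shows "(pisano ^^ j) (lcm a b) = lcm ((pisano ^^ j) a) ((pisano ^^ j) b)"
  by (induction j) (auto simp: pisano_lcm pisano_funpow_pos assms)

lemma pisano_gt_1:
  assumes "m > 1"
  shows "pisano m > 1"
proof -
  have "\<not> fib_period m 1"
    using assms by (auto simp: fib_period_def)
  then have "pisano m \<noteq> 1"
    using pisano_period(2)[of m] assms by auto
  then show ?thesis
    using pisano_period(1)[of m] assms by simp
qed

section \<open>Lifting periods to prime powers\<close>

text \<open>A shift by the period n of \<open>p ^ k\<close> acts as I + p^k A on consecutive pairs.
  Its \<open>p\<close>-th power is I + p^(k+1) A up to multiples of p^(2k), hence trivial modulo
  p^(k+1).\<close>

lemma pisano_power_Suc:
  assumes "p > 0" "k > 0"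
  shows "pisano (p ^ Suc k) dvd p * pisano (p ^ k)"
proof -
  define n where "n = pisano (p ^ k)"
  have "fib_period (p ^ k) n"
    using assms by (simp add: n_def pisano_period)
  then have "int p ^ k dvd int (fib n)" "int p ^ k dvd int (fib (Suc n)) - 1"
    by (simp_all add: fib_period_def)
  then obtain x y where x: "int (fib n) = int p ^ k * x" and "int (fib (Suc n)) - 1 = int p ^ k * y"
    by (elim dvdE)
  then have y: "int (fib (Suc n)) = 1 + int p ^ k * y"
    by linarith
  let ?q = "int p ^ Suc k"
  \<comment> \<open>Since \<open>k > 0\<close>, 2k is at least k + 1, so second-order terms vanish
    modulo \<open>?q\<close>.\<close>
  have d: "?q dvd int p ^ k * int p ^ k"
    using assms by (cases k) auto
  \<comment> \<open>First-order expansion: modulo \<open>?q\<close>, the deviation from the initial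
    pair at index \<open>j * n\<close> is linear in \<open>j\<close>.\<close>
  have *: "?q dvd int (fib (j * n)) - int j * int (fib n) \<and>
        ?q dvd int (fib (Suc (j * n))) - 1 - int j * (int (fib (Suc n)) - 1)" for j
  proof (induction j)
    case (Suc j)
    then obtain u v where "int (fib (j * n)) - int j * (int p ^ k * x) = ?q * u"
      and "int (fib (Suc (j * n))) - 1 - int j * (int p ^ k * y) = ?q * v"
      unfolding x y add_diff_cancel_left' by (elim conjE dvdE)
    then have u: "int (fib (j * n)) = int j * (int p ^ k * x) + ?q * u"
      and v: "int (fib (Suc (j * n))) = 1 + int j * (int p ^ k * y) + ?q * v"
      by linarith+
    have "int (fib (Suc j * n)) - int (Suc j) * int (fib n)
       = (int p ^ k * int p ^ k) * (int j * (2 * x * y - x * x)) +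
         ?q * (u * (1 + int p ^ k * y) + (v - u) * (int p ^ k * x))"
      unfolding mult_Suc add.commute[of n] int_fib_add u v x y by (simp add: algebra_simps)
    moreover have "int (fib (Suc (Suc j * n))) - 1 - int (Suc j) * (int (fib (Suc n)) - 1)
       = (int p ^ k * int p ^ k) * (int j * (y * y + x * x)) +
         ?q * (v * (1 + int p ^ k * y) + u * (int p ^ k * x))"
      unfolding mult_Suc add.commute[of n] int_fib_Suc_add u v x y by (simp add: algebra_simps)
    ultimately show ?case
      using d by (simp only: dvd_add dvd_mult2 dvd_triv_left simp_thms)
  qed auto
  have "?q dvd int (fib (p * n))" "?q dvd int (fib (Suc (p * n))) - 1"
  proof -
    have "?q dvd int p * int (fib n)" "?q dvd int p * (int (fib (Suc n)) - 1)"
      by (simp_all add: x y)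
    with *[of p] show "?q dvd int (fib (p * n))" "?q dvd int (fib (Suc (p * n))) - 1"
      by (metis dvd_add diff_add_cancel)+
  qed
  then have "fib_period (p ^ Suc k) (p * n)"
    by (simp add: fib_period_def)
  then show ?thesis
    using assms by (simp add: pisano_dvd_iff n_def)
qed

lemma pisano_power:
  assumes "p > 0"
  shows "pisano (p ^ Suc k) dvd p ^ k * pisano p"
proof (induction k)
  case (Suc k)
  have "pisano (p ^ Suc (Suc k)) dvd p * pisano (p ^ Suc k)"
    using assms by (intro pisano_power_Suc) auto
  also have "\<dots> dvd p * (p ^ k * pisano p)"
    using Suc by (intro mult_dvd_mono) auto
  finally show ?case by (simp add: mult.assoc)
qed auto

section \<open>Periods modulo primes other than 2 and 5\<close>

text \<open>Binet's formula expanded by the binomial theorem: even powers of sqrt 5 cancel, odd ones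
  double, and one factor sqrt 5 is divided out.\<close>

lemma fib_binomial:
  "2 ^ n * int (fib n) = (\<Sum>k\<le>n. int (n choose k) * (if odd k then 2 * 5 ^ (k div 2) else 0))"
proof -
  have pow: "sqrt 5 ^ k - (- sqrt 5) ^ k = (if odd k then 2 * 5 ^ (k div 2) else 0) * sqrt 5" for k
  proof (cases "even k")
    case False
    then obtain i where "k = 2 * i + 1" by (auto elim: oddE)
    then show ?thesis by (simp add: power_mult)
  qed auto
  have "2 ^ n * real (fib n) * sqrt 5 = (sqrt 5 + 1) ^ n - (- sqrt 5 + 1) ^ n"
    by (simp add: fib_closed_form power_divide field_simps)
  also have "\<dots> = (\<Sum>k\<le>n. real (n choose k) * (sqrt 5 ^ k - (- sqrt 5) ^ k))"
    by (simp only: binomial_ring) (simp add: sum_subtractf algebra_simps)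
  also have "\<dots> = (\<Sum>k\<le>n. real (n choose k) * (if odd k then 2 * 5 ^ (k div 2) else 0)) * sqrt 5"
    by (simp add: pow sum_distrib_right mult.assoc)
  finally have "2 ^ n * real (fib n) = (\<Sum>k\<le>n. real (n choose k) * (if odd k then 2 * 5 ^ (k div 2) else 0))"
    by simp
  also have "\<dots> = of_int (\<Sum>k\<le>n. int (n choose k) * (if odd k then 2 * 5 ^ (k div 2) else 0))"
    by (simp add: if_distrib cong: if_cong)
  finally have "real_of_int (2 ^ n * int (fib n)) = \<dots>"
    by simp
  then show ?thesis by (simp only: of_int_eq_iff)
qed

text \<open>Modulo \<open>p\<close> only the top term of the binomial formula survives, so F(p) is
  congruent to 5^((p-1)/2), whose square is 1 by Fermat.\<close>

lemma fib_prime_square: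
  assumes "prime p" "p \<noteq> 2" "p \<noteq> 5"
  shows "[(int (fib p))\<^sup>2 = 1] (mod int p)"
proof -
  have "odd p" using assms prime_odd_nat prime_ge_2_nat[of p] by fastforce
  have "p > 1" using assms prime_gt_1_nat by blast
  let ?e = "5 ^ (p div 2) :: int"
  let ?t = "\<lambda>k. int (p choose k) * (if odd k then 2 * 5 ^ (k div 2) else 0)"
  have "int p dvd (\<Sum>k<p. ?t k)"
  proof (intro dvd_sum)
    fix k assume "k \<in> {..<p}"
    then show "int p dvd ?t k"
      using dvd_choose_prime[of k p] assms(1) by (cases "k = 0") auto
  qed
  moreover have "2 ^ p * int (fib p) = (\<Sum>k<p. ?t k) + 2 * ?e"
    unfolding fib_binomial using \<open>odd p\<close> by (simp flip: lessThan_Suc_atMost)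
  ultimately have 1: "[2 ^ p * int (fib p) = 2 * ?e] (mod int p)"
    by (simp add: cong_iff_dvd_diff)
  have fermat: "[int a ^ (p - 1) = 1] (mod int p)" if "\<not> p dvd a" for a
    using fermat_theorem[OF assms(1) that] by (simp flip: cong_int_iff)
  have np: "\<not> p dvd 2" "\<not> p dvd 5"
    using assms primes_dvd_imp_eq[of p 2] primes_dvd_imp_eq[of p 5] by auto
  have cop: "coprime 2 (int p)"
    using \<open>odd p\<close> by simp
  have "2 ^ p * int (fib p) = 2 * (2 ^ (p - 1) * int (fib p))"
    using \<open>p > 1\<close> by (cases p) auto
  with 1 have "[2 ^ (p - 1) * int (fib p) = ?e] (mod int p)"
    using cop by (simp add: cong_mult_lcancel)
  moreover have "[2 ^ (p - 1) * int (fib p) = 1 * int (fib p)] (mod int p)"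
    using fermat[OF np(1)] by (intro cong_mult) auto
  ultimately have "[int (fib p) = ?e] (mod int p)"
    by (metis cong_sym cong_trans mult_1)
  then have "[(int (fib p))\<^sup>2 = ?e\<^sup>2] (mod int p)"
    by (rule cong_pow)
  also have "?e\<^sup>2 = int 5 ^ (p - 1)"
    using \<open>odd p\<close> by (auto elim!: oddE simp flip: power_mult simp: mult.commute)
  also have "[\<dots> = 1] (mod int p)"
    by (rule fermat[OF np(2)])
  finally show ?thesis .
qed

text \<open>When F(n) vanishes, the shift by \<open>n\<close> multiplies the sequence by F(n+1);
  shifting twice multiplies by its square, which is 1.\<close>

lemma fib_period_double:
  assumes "int p dvd int (fib n)" "[(int (fib (Suc n)))\<^sup>2 = 1] (mod int p)"
  shows "fib_period p (2 * n)"
proof -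
  have "int (fib (2 * n)) = int (fib n) * (2 * int (fib (Suc n)) - int (fib n))"
    by (simp only: mult_2 int_fib_add) (simp add: algebra_simps)
  moreover have "int (fib (Suc (2 * n))) - 1 = ((int (fib (Suc n)))\<^sup>2 - 1) + int (fib n) * int (fib n)"
    by (simp only: mult_2 int_fib_Suc_add) (simp add: power2_eq_square)
  ultimately show ?thesis
    using assms unfolding fib_period_def cong_iff_dvd_diff by (metis dvd_add dvd_mult2)
qed

text \<open>By Cassini's identity, \<open>F\<^sub>p\<^sup>2 \<equiv> 1\<close> forces \<open>p\<close> to divide \<open>F\<^sub>p\<^sub>-\<^sub>1\<close> or \<open>F\<^sub>p\<^sub>+\<^sub>1\<close>; knowing which of the
  two occurs (quadratic reciprocity) is not needed.\<close>

lemma pisano_prime: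
  assumes "prime p" "p \<noteq> 2" "p \<noteq> 5"
  shows "pisano p dvd 2 * (p - 1) \<or> pisano p dvd 2 * (p + 1)"
proof -
  have "odd p" using assms prime_odd_nat prime_ge_2_nat[of p] by fastforce
  then obtain n where n: "p = Suc n" "even n" by (cases p) auto
  have sq: "int p dvd (int (fib p))\<^sup>2 - 1"
    using fib_prime_square[OF assms] by (simp add: cong_iff_dvd_diff)
  \<comment> \<open>The sign in Cassini's identity comes from \<open>n = p - 1\<close> being
    even.\<close>
  have "int (fib (Suc p)) * int (fib n) = (int (fib p))\<^sup>2 - 1"
    using fib_Cassini_int[of n] n by simp
  with sq have "int p dvd int (fib (Suc p)) \<or> int p dvd int (fib n)"
    using assms(1) by (metis prime_dvd_mult_iff prime_nat_int_transfer)
  then show ?thesis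
  proof
    assume "int p dvd int (fib n)"
    then have "fib_period p (2 * n)"
      using fib_prime_square[OF assms] n by (intro fib_period_double) auto
    then show ?thesis
      using assms(1) n by (simp add: pisano_dvd_iff)
  next
    assume d: "int p dvd int (fib (Suc p))"
    have e: "int (fib (Suc (Suc p))) = int (fib (Suc p)) + int (fib p)" by simp
    \<comment> \<open>As F(p+1) vanishes modulo \<open>p\<close>, F(p+2) is congruent to F(p), which
      supplies the square condition for doubling at p + 1.\<close>
    have "(int (fib (Suc (Suc p))))\<^sup>2 - 1
        = int (fib (Suc p)) * (int (fib (Suc p)) + 2 * int (fib p)) + ((int (fib p))\<^sup>2 - 1)"
      unfolding e by (simp add: power2_eq_square algebra_simps del: fib.simps)
    with d sq have "[(int (fib (Suc (Suc p))))\<^sup>2 = 1] (mod int p)"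
      unfolding cong_iff_dvd_diff by (metis dvd_add dvd_mult2)
    then have "fib_period p (2 * Suc p)"
      using d by (intro fib_period_double)
    then show ?thesis
      using assms(1) prime_gt_0_nat by (simp add: pisano_dvd_iff)
  qed
qed

section \<open>Settling times and reduction to prime powers\<close>

text \<open>Unlike \<^const>\<open>pisano_fixed_point\<close>, this admits the trivial fixed point 1, so that it is closed under
  splitting off prime powers.\<close>

definition settles :: "nat \<Rightarrow> nat \<Rightarrow> bool" where
  "settles N m \<longleftrightarrow> pisano ((pisano ^^ N) m) = (pisano ^^ N) m"

lemma settles_mono:
  assumes "settles N m" "N \<le> M"
  shows "settles M m"
proof -
  have "(pisano ^^ (d + N)) m = (pisano ^^ N) m" for d
    using assms(1) by (induction d) (simp_all add: settles_def)
  from this[of "M - N"] have "(pisano ^^ M) m = (pisano ^^ N) m"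
    using assms(2) by simp
  with assms(1) show ?thesis by (simp add: settles_def)
qed

lemma settles_lcm:
  "a > 0 \<Longrightarrow> b > 0 \<Longrightarrow> settles N a \<Longrightarrow> settles N b \<Longrightarrow> settles N (lcm a b)"
  by (simp add: settles_def pisano_funpow_lcm pisano_lcm pisano_funpow_pos)

lemma settles_Suc: "settles N (pisano m) \<Longrightarrow> settles (Suc N) m"
  by (simp only: settles_def funpow_Suc_right comp_apply)

lemma settles_1: "settles N 1"
proof -
  have "pisano 1 dvd 1"
    by (subst pisano_dvd_iff) (auto simp: fib_period_def)
  then have "settles 0 1"
    by (simp add: settles_def)
  then show ?thesis
    using settles_mono by blast
qed

text \<open>Splitting off the full power of one prime leaves a coprime cofactor, so the product is
  an lcm and \<open>settles_lcm\<close> applies. Assuming the bound for every prime power dividing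
  \<open>m\<close> lets it pass to the cofactor.\<close>

lemma settles_of_prime_powers:
  assumes "m > 0" "\<And>p a. prime p \<Longrightarrow> p ^ a dvd m \<Longrightarrow> settles N (p ^ a)"
  shows "settles N m"
  using assms
proof (induction m rule: less_induct)
  case (less m)
  show ?case
  proof (cases "m = 1")
    case True
    then show ?thesis using settles_1 by simp
  next
    case False
    then obtain p where p: "prime p" "p dvd m"
      using prime_factor_nat by blast
    then obtain k n where kn: "\<not> p dvd n" "m = n * p ^ k"
      using prime_power_canonical[of p m] less.prems(1) by blast
    have "k > 0" using p kn by (cases k) auto
    then have "p ^ k > 1"
      using p prime_gt_1_nat one_less_power by blast
    have "n > 0" using kn less.prems(1) by simp
    have "n < m" using kn \<open>p ^ k > 1\<close> \<open>n > 0\<close> by simp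
    then have "settles N n"
      using \<open>n > 0\<close>
    proof (rule less.IH)
      fix q a :: nat
      assume "prime q" "q ^ a dvd n"
      then show "settles N (q ^ a)"
        by (intro less.prems(2)) (simp_all add: kn(2))
    qed
    moreover have "settles N (p ^ k)"
      using p(1) by (rule less.prems(2)) (simp add: kn(2))
    moreover have "coprime n (p ^ k)"
      using p(1) kn(1) by (metis coprime_commute coprime_power_right_iff prime_imp_coprime)
    then have "m = lcm n (p ^ k)"
      by (simp add: kn lcm_coprime)
    ultimately show ?thesis
      using settles_lcm[of n "p ^ k"] \<open>n > 0\<close> \<open>p ^ k > 1\<close> by (metis less_trans zero_less_one)
  qed
qed

text \<open>Sorts the prime powers dividing a bound for the period of a power of \<open>p\<close>:
  the prime \<open>p\<close> itself against the primes of the cofactor.\<close>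

lemma prime_power_dvd_mult_cases:
  fixes p q :: nat
  assumes "prime p" "prime q" "q ^ b dvd p ^ k * c" "\<not> p dvd c"
  obtains "q = p" "b \<le> k" | "q \<noteq> p" "q ^ b dvd c"
proof (cases "q = p")
  case True
  have "coprime (p ^ b) c"
    using assms by (simp add: prime_imp_coprime)
  then have "p ^ b dvd p ^ k"
    using assms(3) True coprime_dvd_mult_left_iff by blast
  then have "b \<le> k"
    using assms(1) by (metis not_prime_0 not_prime_1 power_dvd_imp_le prime_gt_1_nat)
  with True that(1) show ?thesis by blast
next
  case False
  have "coprime (q ^ b) (p ^ k)"
    using assms(1,2) False by (simp add: primes_coprime)
  then have "q ^ b dvd c"
    using assms(3) coprime_dvd_mult_right_iff by blast
  with False that(2) show ?thesis by blast
qed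

section \<open>Powers of 2 and 5\<close>

lemma fib_values:
  "fib 3 = 2" "fib 4 = 3" "fib 5 = 5" "fib 6 = 8" "fib 7 = 13" "fib 8 = 21" "fib 9 = 34"
  "fib 12 = 144" "fib 13 = 233" "fib 20 = 6765" "fib 21 = 10946"
proof -
  have rec: "fib (numeral k) = fib (pred_numeral k - 1) + fib (pred_numeral k)"
    if "pred_numeral k > 0" for k
    using that by (cases "pred_numeral k") (auto simp: numeral_eq_Suc)
  show "fib 3 = 2" "fib 4 = 3" "fib 5 = 5" "fib 6 = 8" "fib 7 = 13" "fib 8 = 21" "fib 9 = 34"
    "fib 12 = 144" "fib 13 = 233" "fib 20 = 6765" "fib 21 = 10946"
    by (simp_all add: rec)
qed

text \<open>In each case one period is verified and its maximal proper divisors are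
  rejected.\<close>

lemma pisano_values: "pisano 3 = 8" "pisano 4 = 6" "pisano 8 = 12"
proof -
  have le: "d = 0 \<or> d = 1 \<or> d = 2 \<or> d = 3 \<or> d = 4 \<or> d = 5 \<or> d = 6 \<or> d = 7 \<or> d = 8 \<or> d = 9 \<or>
      d = 10 \<or> d = 11 \<or> d = 12" if "d \<le> 12" for d :: nat
    using that by presburger
  have pi3: "pisano 3 dvd 8" "\<not> pisano 3 dvd 4"
    by (simp_all add: pisano_dvd_iff fib_period_def fib_values del: fib.simps)
  then have "pisano 3 \<le> 12"
    using dvd_imp_le[of "pisano 3" 8] by simp
  from le[OF this] show "pisano 3 = 8"
    using pi3 by (elim disjE) simp_all
  have pi4: "pisano 4 dvd 6" "\<not> pisano 4 dvd 2" "\<not> pisano 4 dvd 3"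
    by (simp_all add: pisano_dvd_iff fib_period_def fib_values del: fib.simps)
  then have "pisano 4 \<le> 12"
    using dvd_imp_le[of "pisano 4" 6] by simp
  from le[OF this] show "pisano 4 = 6"
    using pi4 by (elim disjE) simp_all
  have pi8: "pisano 8 dvd 12" "\<not> pisano 8 dvd 4" "\<not> pisano 8 dvd 6"
    by (simp_all add: pisano_dvd_iff fib_period_def fib_values del: fib.simps)
  then have "pisano 8 \<le> 12"
    using dvd_imp_le[of "pisano 8" 12] by simp
  from le[OF this] show "pisano 8 = 12"
    using pi8 by (elim disjE) simp_all
qed

text \<open>The trajectory is 3, 8, 12, 24, and 24 is fixed; the periods of 12 and 24 come from the
  lcm rule.\<close>

lemma settles_3: "settles 3 3"
proof -
  have "lcm 4 3 = (12::nat)" "lcm 8 3 = (24::nat)" "lcm 6 8 = (24::nat)" "lcm 12 8 = (24::nat)"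
    by code_simp+
  then have "pisano 12 = 24" "pisano 24 = 24"
    using pisano_lcm[of 4 3] pisano_lcm[of 8 3] by (simp_all add: pisano_values)
  then have "settles (Suc (Suc (Suc 0))) 3"
    by (simp add: settles_def pisano_values)
  then show ?thesis by (rule settles_mono) simp
qed

text \<open>For \<open>a > 0\<close> the period divides 2^(a-1) * 3, so one step lowers the exponent
  of 2 and may add a factor 3, whose settling time is the offset 3.\<close>

lemma settles_power_2: "settles (a + 3) (2 ^ a)"
proof (induction a rule: less_induct)
  case (less a)
  show ?case
  proof (cases a)
    case 0
    then show ?thesis using settles_1 by simp
  next
    case (Suc i)
    have "pisano 2 dvd 3"
      by (simp add: pisano_dvd_iff fib_period_def fib_values)
    then have d: "pisano (2 ^ a) dvd 2 ^ i * 3"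
      unfolding Suc using pisano_power[of 2 i] by (meson dvd_trans mult_dvd_mono dvd_refl zero_less_numeral)
    have "settles (i + 3) (pisano (2 ^ a))"
    proof (rule settles_of_prime_powers)
      show "pisano (2 ^ a) > 0"
        by (simp add: pisano_period)
      fix q b :: nat
      assume q: "prime q" "q ^ b dvd pisano (2 ^ a)"
      from q d have dvd: "q ^ b dvd 2 ^ i * 3"
        using dvd_trans by blast
      have "\<not> 2 dvd (3::nat)" by simp
      with two_is_prime_nat q(1) dvd show "settles (i + 3) (q ^ b)"
      proof (cases rule: prime_power_dvd_mult_cases)
        case 1
        then have "settles (b + 3) (q ^ b)"
          using less.IH[of b] Suc by simp
        then show ?thesis
          using settles_mono 1 by simp
      next
        case 2
        have "prime (3::nat)" by simp
        with 2 have "q ^ b = 1 \<or> q ^ b = 3"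
          using prime_nat_iff by blast
        then show ?thesis
          using settles_1 settles_mono[OF settles_3] by auto
      qed
    qed
    then show ?thesis
      by (rule settles_mono[OF settles_Suc]) (simp add: Suc)
  qed
qed

text \<open>Each further iterate of \<open>x\<close> is the lcm of the preceding iterates of
  \<open>d\<close> and \<open>x\<close>. Once \<open>d\<close> has settled, its final value is
  already absorbed. This serves powers of 5, whose exponent may fail to drop.\<close>

lemma settles_pisano_eq_lcm:
  assumes "pisano x = lcm d x" "settles N d" "d > 0" "x > 0"
  shows "settles (Suc N) x"
proof -
  have step: "(pisano ^^ Suc j) x = lcm ((pisano ^^ j) d) ((pisano ^^ j) x)" for j
    using assms by (simp only: funpow_Suc_right comp_apply pisano_funpow_lcm)
  have "(pisano ^^ Suc (Suc N)) x = lcm ((pisano ^^ Suc N) d) ((pisano ^^ Suc N) x)"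
    by (rule step)
  also have "(pisano ^^ Suc N) d = (pisano ^^ N) d"
    using assms(2) by (simp add: settles_def)
  also have "lcm \<dots> ((pisano ^^ Suc N) x) = (pisano ^^ Suc N) x"
    unfolding step by (simp add: lcm.assoc[symmetric])
  finally show ?thesis
    by (simp add: settles_def)
qed

text \<open>The period is the lcm of a divisor of 4 and some 5^e with e at most \<open>k\<close>. If
  e = \<open>k\<close>, the absorption lemma applies; otherwise induction does.\<close>

lemma settles_power_5: "settles (k + 7) (5 ^ k)"
proof (induction k rule: less_induct)
  case (less k)
  have "pisano (5 ^ k) dvd 4 * 5 ^ k"
  proof (cases k)
    case 0
    then show ?thesis
      using settles_1[of 0] by (simp add: settles_def)
  next
    case (Suc i)
    have "pisano 5 dvd 20"
      by (simp add: pisano_dvd_iff fib_period_def fib_values)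
    then have "pisano (5 ^ k) dvd 5 ^ i * 20"
      unfolding Suc using pisano_power[of 5 i] by (meson dvd_trans mult_dvd_mono dvd_refl zero_less_numeral)
    then show ?thesis
      by (simp add: Suc mult.commute)
  qed
  then obtain d f where df: "pisano (5 ^ k) = d * f" "d dvd 4" "f dvd 5 ^ k"
    using division_decomp by blast
  have "prime (5::nat)" by simp
  then obtain e where e: "e \<le> k" "f = 5 ^ e"
    using df(3) divides_primepow_nat by blast
  have "d dvd 2 ^ 2" using df(2) by simp
  then obtain i where i: "i \<le> 2" "d = 2 ^ i"
    using divides_primepow_nat two_is_prime_nat by blast
  \<comment> \<open>The exponent of 2 is at most 2, and 2 + 3 = 5.\<close>
  have d: "settles 5 d"
    unfolding i(2) using settles_power_2 by (rule settles_mono) (use i in simp)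
  have "coprime (2::nat) 5" by (simp add: primes_coprime)
  then have "coprime d f" unfolding i e by simp
  then have lcm: "pisano (5 ^ k) = lcm d f"
    by (simp add: df(1) lcm_coprime)
  have pos: "d > 0" "f > 0" by (simp_all add: i e)
  show ?case
  proof (cases "e = k")
    case True
    then have "settles (Suc 5) (5 ^ k)"
      using lcm d pos e by (intro settles_pisano_eq_lcm) auto
    then show ?thesis by (rule settles_mono) simp
  next
    case False
    with e have "e < k" by simp
    then have "settles (k + 6) f"
      unfolding e(2) by (intro settles_mono[OF less.IH]) auto
    moreover have "settles (k + 6) d"
      using d by (rule settles_mono) simp
    ultimately have "settles (k + 6) (pisano (5 ^ k))"
      unfolding lcm using pos settles_lcm by blast
    from settles_Suc[OF this] show ?thesis by (rule settles_mono) simp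
  qed
qed

section \<open>Contraction for the remaining primes\<close>

text \<open>As \<open>p\<close> is odd, 4 divides both 2(p-1) and 2(p+1). Odd prime powers in the
  period must then divide the small cofactor \<open>h\<close>.\<close>

lemma pisano_prime_dvd_4_mult:
  assumes "prime p" "p \<noteq> 2" "p \<noteq> 5"
  obtains h where "pisano p dvd 4 * h" "h > 0" "2 * h \<le> p + 1"
proof -
  have "odd p" using assms prime_odd_nat prime_ge_2_nat[of p] by fastforce
  then obtain n where n: "p = 2 * n + 1" by (auto elim: oddE)
  have "n > 0" using assms(1) n by (cases n) auto
  have "2 * (p - 1) = 4 * n" "2 * (p + 1) = 4 * (n + 1)"
    using n by simp_all
  with pisano_prime[OF assms] have "pisano p dvd 4 * n \<or> pisano p dvd 4 * (n + 1)"
    by metis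
  then show thesis
    using that[of n] that[of "n + 1"] \<open>n > 0\<close> n by auto
qed

text \<open>Compares powers of 2, using 3/2 < 2. It turns a size bound into an exponent bound, as
  the settling times for 2 and 5 require.\<close>

lemma exponent_le_of_power_le:
  fixes p :: nat
  assumes "p \<ge> 2" "p ^ k * 2 ^ N \<le> c * 3 ^ N" "c \<le> 2 ^ d"
  shows "k \<le> N + d"
proof -
  have "2 ^ (k + N) \<le> p ^ k * 2 ^ N"
    using assms(1) by (simp add: power_add power_mono)
  also have "\<dots> \<le> c * 3 ^ N" by fact
  also have "\<dots> \<le> 2 ^ d * 4 ^ N"
    using assms(3) by (intro mult_mono power_mono) auto
  also have "\<dots> = (2::nat) ^ (d + 2 * N)"
    by (simp add: power_add power_mult)
  finally have "k + N \<le> d + 2 * N"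
    by (rule power_le_imp_le_exp[rotated]) simp
  then show ?thesis by simp
qed

text \<open>The hypothesis is p^k <= (3/2)^N, cleared of denominators. Each step shrinks odd prime
  powers by a factor of at least 3/2, while powers of 2 and 5 are settled directly; the constant 10
  covers their offsets.\<close>

lemma settles_prime_power:
  assumes "prime p" "p ^ k * 2 ^ N \<le> 3 ^ N"
  shows "settles (N + 10) (p ^ k)"
  using assms
proof (induction N arbitrary: p k)
  case 0
  then have "p ^ k = 1"
    using prime_gt_0_nat[of p] by (auto simp: le_Suc_eq)
  then show ?case by (metis settles_1)
next
  case (Suc M)
  have "p \<ge> 2" using Suc.prems(1) prime_ge_2_nat by blast
  have "k \<le> Suc M"
    using exponent_le_of_power_le[of p k "Suc M" 1 0] \<open>p \<ge> 2\<close> Suc.prems(2) by simp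
  consider "k = 0" | "p = 2" | "p = 5" | i where "k = Suc i" "p \<noteq> 2" "p \<noteq> 5"
    by (cases k) auto
  then show ?case
  proof cases
    case 1
    then show ?thesis using settles_1 by simp
  next
    case 2
    have "settles (k + 3) (p ^ k)" using settles_power_2 2 by simp
    then show ?thesis by (rule settles_mono) (use \<open>k \<le> Suc M\<close> in simp)
  next
    case 3
    have "settles (k + 7) (p ^ k)" using settles_power_5 3 by simp
    then show ?thesis by (rule settles_mono) (use \<open>k \<le> Suc M\<close> in simp)
  next
    case 4
    obtain h where h: "pisano p dvd 4 * h" "h > 0" "2 * h \<le> p + 1"
      using pisano_prime_dvd_4_mult Suc.prems(1) 4 by blast
    have "p \<ge> 3" using \<open>p \<ge> 2\<close> 4 by simp
    then have "h < p" using h(3) by simp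
    have ndvd: "\<not> p dvd 4 * h"
    proof
      assume "p dvd 4 * h"
      then have "p dvd 2 ^ 2 \<or> p dvd h"
        using Suc.prems(1) by (simp add: prime_dvd_mult_iff)
      then have "p dvd 2"
        using Suc.prems(1) \<open>h < p\<close> h(2) by (meson nat_dvd_not_less prime_dvd_power)
      then have "p \<le> 2" by (rule dvd_imp_le) simp
      with \<open>p \<ge> 3\<close> show False by simp
    qed
    have bound: "p * 2 ^ Suc M \<le> 3 ^ Suc M"
    proof -
      have "p \<le> p ^ k" using 4 \<open>p \<ge> 3\<close> by simp
      then have "p * 2 ^ Suc M \<le> p ^ k * 2 ^ Suc M" by (rule mult_le_mono1)
      with Suc.prems(2) show ?thesis by linarith
    qed
    have "pisano (p ^ k) dvd p ^ i * (4 * h)"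
      unfolding 4(1) using pisano_power[of p i] h(1) \<open>p \<ge> 3\<close>
      by (meson dvd_trans mult_dvd_mono dvd_refl prime_gt_0_nat Suc.prems(1))
    have "settles (M + 10) (pisano (p ^ k))"
    proof (rule settles_of_prime_powers)
      show "pisano (p ^ k) > 0"
        using \<open>p \<ge> 3\<close> by (simp add: pisano_period)
      fix q b :: nat
      assume q: "prime q" "q ^ b dvd pisano (p ^ k)"
      then have "q ^ b dvd p ^ i * (4 * h)"
        using \<open>pisano (p ^ k) dvd p ^ i * (4 * h)\<close> dvd_trans by blast
      from Suc.prems(1) q(1) this ndvd show "settles (M + 10) (q ^ b)"
      proof (cases rule: prime_power_dvd_mult_cases)
        case 1
        \<comment> \<open>The exponent of \<open>p\<close> has dropped, a gain of at least
          3.\<close>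
        have "p ^ b \<le> p ^ i" using 1 \<open>p \<ge> 3\<close> by (simp add: power_increasing)
        then have "3 * p ^ b \<le> p ^ k"
          unfolding 4(1) power_Suc using \<open>p \<ge> 3\<close> by (intro mult_le_mono)
        then have "(3 * p ^ b) * 2 ^ M \<le> p ^ k * 2 ^ M" by (rule mult_le_mono1)
        moreover have "2 * (p ^ k * 2 ^ M) \<le> 3 * 3 ^ M"
          using Suc.prems(2) by (simp only: power_Suc mult.left_commute)
        ultimately have "p ^ b * 2 ^ M \<le> 3 ^ M"
          unfolding mult.assoc by linarith
        then have "q ^ b * 2 ^ M \<le> 3 ^ M"
          using 1 by simp
        with q(1) show ?thesis by (rule Suc.IH)
      next
        case 2
        show ?thesis
        proof (cases "q = 2")
          case True
          \<comment> \<open>A power of 2 may exceed the contracted bound, but it is below 4p, which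
            limits \<open>b\<close> without the induction hypothesis.\<close>
          have "2 ^ b \<le> 4 * h"
            using 2 True h(2) dvd_imp_le[of "q ^ b" "4 * h"] by simp
          also have "\<dots> \<le> 4 * p" using \<open>h < p\<close> by simp
          finally have "2 ^ b * 2 ^ Suc M \<le> 4 * p * 2 ^ Suc M" by (rule mult_le_mono1)
          with bound have "2 ^ b * 2 ^ Suc M \<le> (4::nat) * 3 ^ Suc M"
            unfolding mult.assoc by linarith
          then have "b \<le> Suc M + 2"
            using exponent_le_of_power_le[of 2 b "Suc M" 4 2] by simp
          have "settles (b + 3) (q ^ b)" using settles_power_2 True by simp
          then show ?thesis by (rule settles_mono) (use \<open>b \<le> Suc M + 2\<close> in simp)
        next
          case False
          have "coprime q 2"
            using q(1) two_is_prime_nat False by (rule primes_coprime)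
          then have "coprime (q ^ b) (2 ^ 2)"
            by (simp only: coprime_power_left_iff coprime_power_right_iff simp_thms)
          then have "coprime (q ^ b) 4" by simp
          then have "q ^ b dvd h"
            using 2 coprime_dvd_mult_right_iff by blast
          then have "q ^ b \<le> h" using h(2) dvd_imp_le by blast
          \<comment> \<open>From 2h <= p + 1 follows 6h <= 3p + 3 <= 4p, since \<open>p\<close> is
            at least 3.\<close>
          then have "3 * q ^ b \<le> 2 * p" using h(3) \<open>p \<ge> 3\<close> by simp
          then have "(3 * q ^ b) * 2 ^ M \<le> (2 * p) * 2 ^ M" by (rule mult_le_mono1)
          moreover have "2 * (p * 2 ^ M) \<le> 3 * 3 ^ M"
            using bound by (simp only: power_Suc mult.left_commute)
          ultimately have "q ^ b * 2 ^ M \<le> 3 ^ M"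
            unfolding mult.assoc by linarith
          with q(1) show ?thesis by (rule Suc.IH)
        qed
      qed
    qed
    from settles_Suc[OF this] show ?thesis by (rule settles_mono) simp
  qed
qed

lemma settles_bound:
  assumes "m > 0" "m * 2 ^ N \<le> 3 ^ N"
  shows "settles (N + 10) m"
proof (rule settles_of_prime_powers[OF assms(1)])
  fix p a :: nat
  assume p: "prime p" "p ^ a dvd m"
  then have "p ^ a \<le> m" using assms(1) dvd_imp_le by blast
  then have "p ^ a * 2 ^ N \<le> m * 2 ^ N" by (rule mult_le_mono1)
  also have "\<dots> \<le> 3 ^ N" by fact
  finally show "settles (N + 10) (p ^ a)"
    using p(1) settles_prime_power by blast
qed

section \<open>The logarithmic bound\<close>

text \<open>A trajectory starting above 1 stays above 1, so it settles at a genuine fixed point and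
  not at 1.\<close>

lemma pisano_iterations_le:
  assumes "m > 1" "settles N m"
  shows "pisano_iterations m \<le> enat N"
proof -
  have "(pisano ^^ j) m > 1" for j
    by (induction j) (use assms(1) pisano_gt_1 in auto)
  then have "pisano_fixed_point ((pisano ^^ N) m)"
    using assms(2) by (simp add: pisano_fixed_point_def settles_def)
  then show ?thesis
    unfolding pisano_iterations_def by (intro INF_lower) simp
qed

lemma pisano_iterations_le_ln:
  assumes "m > 1"
  shows "ereal_of_enat (pisano_iterations m) \<le> ereal ((1 / ln (3 / 2) + 11 / ln 2) * ln (real m))"
proof -
  \<comment> \<open>The least exponent with m <= (3/2)^N.\<close>
  define N where "N = nat \<lceil>log (3 / 2) (real m)\<rceil>"
  have "log (3 / 2) (real m) \<ge> 0"
    using assms by simp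
  then have N: "log (3 / 2) (real m) \<le> real N" "real N \<le> log (3 / 2) (real m) + 1"
    unfolding N_def by linarith+
  have "real m = (3 / 2) powr log (3 / 2) (real m)"
    using assms by simp
  also have "\<dots> \<le> (3 / 2) powr real N"
    using N(1) by (intro powr_mono) auto
  also have "\<dots> = (3 / 2) ^ N"
    by (simp add: powr_realpow)
  finally have "real m * 2 ^ N \<le> 3 ^ N"
    by (simp add: power_divide field_simps)
  then have "real (m * 2 ^ N) \<le> real (3 ^ N)" by simp
  then have "m * 2 ^ N \<le> 3 ^ N" by (simp only: of_nat_le_iff)
  then have "pisano_iterations m \<le> enat (N + 10)"
    using assms by (intro pisano_iterations_le settles_bound) auto
  then have "ereal_of_enat (pisano_iterations m) \<le> ereal_of_enat (enat (N + 10))"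
    by (simp only: ereal_of_enat_le_iff)
  also have "\<dots> = ereal (real N + 10)" by simp
  also have "\<dots> \<le> ereal ((1 / ln (3 / 2) + 11 / ln 2) * ln (real m))"
  proof -
    \<comment> \<open>The 11 collects the 10 from \<open>settles_bound\<close> and 1 from rounding
      up; \<open>m\<close> being at least 2 lets ln m / ln 2 absorb it.\<close>
    have "11 \<le> 11 / ln 2 * ln (real m)"
      using assms by (simp add: field_simps)
    moreover have "log (3 / 2) (real m) = 1 / ln (3 / 2) * ln (real m)"
      by (simp add: log_def)
    ultimately show ?thesis
      using N(2) by (simp add: distrib_right)
  qed
  finally show ?thesis .
qed

theorem theorem1p3:
  "limsup (\<lambda>m::nat. ereal_of_enat (pisano_iterations m) / ereal (ln (real m))) < \<infinity>"
proof -
  let ?C = "1 / ln (3 / 2) + 11 / ln 2 :: real"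
  have "ereal_of_enat (pisano_iterations m) / ereal (ln (real m)) \<le> ereal ?C" if "m > 1" for m
  proof -
    have "ereal (ln (real m)) > 0" using that by simp
    then show ?thesis
      using pisano_iterations_le_ln[OF that]
      by (subst ereal_divide_le_pos) (auto simp: mult.commute)
  qed
  \<comment> \<open>The limsup ignores the values at 0 and 1, where ln m is not positive.\<close>
  then have "\<forall>\<^sub>F m in sequentially. ereal_of_enat (pisano_iterations m) / ereal (ln (real m)) \<le> ereal ?C"
    by (intro eventually_mono[OF eventually_gt_at_top[of 1]]) auto
  then have "limsup (\<lambda>m::nat. ereal_of_enat (pisano_iterations m) / ereal (ln (real m))) \<le> ereal ?C"
    by (rule Limsup_bounded)
  then show ?thesis
    using le_less_trans by fastforce
qed

end
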